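(* For all $\alpha,\beta\in\mathbb{C}$ with $\mathfrak{Re}(\alpha)>0$ and $\mathfrak{Re}(\beta)\ge1$, the following equalities hold: $$I_{0^+}^\alpha\left[x^{\beta-1}\log\Gamma(x)\right](1)=\frac{1}{\Gamma(\alpha)}\sum_{n=0}^{\infty}(-1)^n\binom{\alpha-1}{n}\Gamma(n+\beta)\,I_{1^-}^{n+\beta}\log\Gamma(0),$$ $$I_{1^-}^\alpha\left[x^{\beta-1}\log\Gamma(x)\right](0)=\frac{\Gamma(\alpha+\beta-1)}{\Gamma(\alpha)}\,I_{1^-}^{\alpha+\beta-1}\log\Gamma(0).$$
   Context: $\Gamma$ is Euler's gamma function and $\log\Gamma(t)$ is the real logarithm for $t\in(0,1]$. For $\mathfrak{Re}(\alpha)>0$ the left- and right-sided Riemann-Liouville fractional integrals of order $\alpha$ of $f$ on $[a,b]$ are $I_{a^+}^\alpha f(x)=\frac{1}{\Gamma(\alpha)}\int_a^x (x-t)^{\alpha-1}f(t)\,dt$ ($a<x\le b$) and $I_{b^-}^\alpha f(x)=\frac{1}{\Gamma(\alpha)}\int_x^b (t-x)^{\alpha-1}f(t)\,dt$ ($a\le x<b$). Here $a=0$, $b=1$ (and the same formulas are used for complex-valued $f$ on $(0,1)$), so $I_{0^+}^\alpha[f(x)](1)=\frac{1}{\Gamma(\alpha)}\int_0^1(1-t)^{\alpha-1}f(t)\,dt$, $I_{1^-}^\alpha[f(x)](0)=\frac{1}{\Gamma(\alpha)}\int_0^1 t^{\alpha-1}f(t)\,dt$, and $I_{1^-}^{s}\log\Gamma(0)=\frac{1}{\Gamma(s)}\int_0^1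 t^{s-1}\log\Gamma(t)\,dt$. For positive real $y$ and complex $s$, $y^s=e^{s\log y}$. The generalized binomial coefficient is $\binom{\alpha-1}{n}=\frac{(\alpha-1)(\alpha-2)\cdots(\alpha-n)}{n!}$, equal to $1$ for $n=0$. *)

theory Defs
  imports "HOL-Analysis.Analysis"
begin

text \<open>
  Riemann-Liouville fractional integrals of complex order, as Lebesgue integrals. On the open
  intervals of integration the base of the power is a positive real, so \<open>powr\<close> on the complex
  numbers is \<open>y\<^sup>s = exp (s * ln y)\<close>. Since the Bochner integral of a non-integrable function
  is 0, existence is stated separately by the predicates \<open>rl_left_exists\<close> and
  \<open>rl_right_exists\<close>.
\<close>

definition rl_left_kernel :: "complex \<Rightarrow> (real \<Rightarrow> complex) \<Rightarrow> real \<Rightarrow> real \<Rightarrow> complex" where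
  "rl_left_kernel \<alpha> f x t = complex_of_real (x - t) powr (\<alpha> - 1) * f t"

definition rl_right_kernel :: "complex \<Rightarrow> (real \<Rightarrow> complex) \<Rightarrow> real \<Rightarrow> real \<Rightarrow> complex" where
  "rl_right_kernel \<alpha> f x t = complex_of_real (t - x) powr (\<alpha> - 1) * f t"

definition rl_left_exists :: "real \<Rightarrow> complex \<Rightarrow> (real \<Rightarrow> complex) \<Rightarrow> real \<Rightarrow> bool" where
  "rl_left_exists a \<alpha> f x \<longleftrightarrow> set_integrable lborel {a<..<x} (rl_left_kernel \<alpha> f x)"

definition rl_right_exists :: "real \<Rightarrow> complex \<Rightarrow> (real \<Rightarrow> complex) \<Rightarrow> real \<Rightarrow> bool" where
  "rl_right_exists b \<alpha> f x \<longleftrightarrow> set_integrable lborel {x<..<b} (rl_right_kernel \<alpha> f x)"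

definition rl_left :: "real \<Rightarrow> complex \<Rightarrow> (real \<Rightarrow> complex) \<Rightarrow> real \<Rightarrow> complex" where
  "rl_left a \<alpha> f x = 1 / Gamma \<alpha> * (LINT t:{a<..<x}|lborel. rl_left_kernel \<alpha> f x t)"

definition rl_right :: "real \<Rightarrow> complex \<Rightarrow> (real \<Rightarrow> complex) \<Rightarrow> real \<Rightarrow> complex" where
  "rl_right b \<alpha> f x = 1 / Gamma \<alpha> * (LINT t:{x<..<b}|lborel. rl_right_kernel \<alpha> f x t)"

definition log_Gamma :: "real \<Rightarrow> complex" where
  "log_Gamma t = complex_of_real (ln (Gamma t))"

end

theory Submission
  imports Defs "HOL-Real_Asymp.Real_Asymp"
begin

text \<open>
  The second identity is no more than \<open>t\<^sup>\<alpha>\<^sup>-\<^sup>1 t\<^sup>\<beta>\<^sup>-\<^sup>1 = t\<^sup>\<alpha>\<^sup>+\<^sup>\<beta>\<^sup>-\<^sup>2\<close> under the integral sign: both sides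
  are \<open>1 / \<Gamma>(\<alpha>)\<close> times the same integral. The first one comes from expanding
  \<open>(1 - t)\<^sup>\<alpha>\<^sup>-\<^sup>1\<close> in the binomial series, which converges for every \<open>0 < t < 1\<close>, and integrating
  term by term. The factor \<open>\<Gamma>(n + \<beta>)\<close> in the series cancels the normalisation of the fractional
  integral, so that the \<open>n\<close>-th term is the signed binomial coefficient times the moment
  \<open>\<integral> t\<^sup>n\<^sup>+\<^sup>\<beta>\<^sup>-\<^sup>1 log \<Gamma>(t) dt\<close> over the unit interval.

  What has to be justified is existence of the moments and the exchange of sum and integral. Both
  follow from the inequality \<open>0 \<le> log \<Gamma>(t) \<le> - ln t\<close> on the unit interval
  (\<open>norm_log_Gamma_le\<close>), a consequence of the convexity of \<open>log \<Gamma>\<close> and its zeros at 1 and 2.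
  Since \<open>\<integral> t\<^sup>c\<^sup>-\<^sup>1 (- ln t) dt = 1 / c\<^sup>2\<close> for \<open>c > 0\<close> (\<open>neg_ln_moment_eq\<close>), the moment
  \<open>\<integral> t\<^sup>s\<^sup>-\<^sup>1 log \<Gamma>(t) dt\<close> exists when \<open>Re s > 0\<close>, and the absolute moment is at most \<open>1 / (Re s)\<^sup>2\<close>.
  For \<open>Re \<alpha> \<ge> 0\<close> the coefficients of the binomial series are bounded
  (\<open>gbinomial_bounded\<close>), so the integrals of the absolute values of the terms
  are dominated by a multiple of \<open>1 / n\<^sup>2\<close>. This gives
  absolute convergence, hence the exchange, and also integrability of the limit, that is, existence
  of the left-sided fractional integral.
\<close>

text \<open>
  The fundamental theorem of calculus for nonnegative integrands on an open interval yields
  integrability and the value at once, from a primitive with limits at both end points.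
\<close>

lemma neg_ln_moment:
  fixes c :: real
  assumes "c > 0"
  shows neg_ln_moment_integrable:
      "set_integrable lborel {0<..<1} (\<lambda>t. t powr (c - 1) * (- ln t))"
    and neg_ln_moment_eq:
      "(LINT t:{0<..<1}|lborel. t powr (c - 1) * (- ln t)) = 1 / c\<^sup>2"
proof -
  define F where "F = (\<lambda>t::real. t powr c * (1 / c\<^sup>2 - ln t / c))"
  have deriv: "DERIV F t :> t powr (c - 1) * (- ln t)" if "t > 0" for t
  proof -
    have "DERIV F t :> t powr c * (- (inverse t / c))
            + c * t powr (c - 1) * (1 / c\<^sup>2 - ln t / c)"
      unfolding F_def using that assms
      by (auto intro!: derivative_eq_intros simp: powr_diff field_simps)
    also have "t powr c * (- (inverse t / c)) + c * t powr (c - 1) * (1 / c\<^sup>2 - ln t / c)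
        = t powr (c - 1) * (- ln t)"
      using that assms by (simp add: powr_diff field_simps power2_eq_square)
    finally show ?thesis .
  qed
  have at_0: "((F \<circ> real_of_ereal) \<longlongrightarrow> 0) (at_right (ereal 0))"
    unfolding ereal_tendsto_simps F_def using assms by real_asymp
  have "isCont F 1"
    using deriv[of 1] DERIV_isCont by fastforce
  then have "(F \<longlongrightarrow> 1 / c\<^sup>2) (at_left 1)"
    by (auto simp: isCont_def F_def intro: tendsto_within_subset)
  then have at_1: "((F \<circ> real_of_ereal) \<longlongrightarrow> 1 / c\<^sup>2) (at_left (ereal 1))"
    unfolding ereal_tendsto_simps .
  note FTC = interval_integral_FTC_nonneg[of "ereal 0" "ereal 1" F
      "\<lambda>t. t powr (c - 1) * (- ln t)", OF _ _ _ _ at_0 at_1]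
  have nonneg: "0 \<le> t powr (c - 1) * (- ln t)" if "0 < t" "t < 1" for t :: real
    using that by (simp add: mult_nonneg_nonpos)
  have cont: "isCont (\<lambda>t. t powr (c - 1) * (- ln t)) t" if "t > 0" for t :: real
    using that by (intro continuous_intros) auto
  have "set_integrable lborel (einterval (ereal 0) (ereal 1)) (\<lambda>t. t powr (c - 1) * (- ln t))"
    by (rule FTC) (use deriv cont nonneg in auto)
  then show "set_integrable lborel {0<..<1} (\<lambda>t. t powr (c - 1) * (- ln t))"
    by simp
  have "(LBINT t=ereal 0..ereal 1. t powr (c - 1) * (- ln t)) = 1 / c\<^sup>2 - 0"
    by (rule FTC) (use deriv cont nonneg in auto)
  then show "(LINT t:{0<..<1}|lborel. t powr (c - 1) * (- ln t)) = 1 / c\<^sup>2"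
    by (simp add: interval_lebesgue_integral_def)
qed

text \<open>
  Both bounds come from the convexity of \<open>ln \<circ> Gamma\<close>, which vanishes at 1 and 2. Between these
  zeros it is at most 0, so that \<open>Gamma (t + 1) = t * Gamma t\<close> gives the upper bound;
  to the left of 1 it is at least 0, because 1 lies between \<open>t\<close> and 2.
\<close>

lemma norm_log_Gamma_le:
  assumes "0 < t" "t < 1"
  shows "norm (log_Gamma t) \<le> - ln t"
proof -
  have Gamma_pos: "Gamma t > 0" "Gamma (t + 1) > 0"
    using assms by (auto intro: Gamma_real_pos)
  have Gamma_2: "Gamma (2::real) = 1"
    using Gamma_fact[of 1, where 'a = real] by simp
  have "ln (Gamma (t + 1)) \<le> 0"
    using convex_onD[OF log_convex_Gamma_real, of t 1 2] assms Gamma_2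
    by (simp add: algebra_simps)
  moreover have "Gamma (t + 1) = t * Gamma t"
    using assms by (intro Gamma_plus1) (auto elim!: nonpos_Ints_cases)
  ultimately have upper: "ln (Gamma t) \<le> - ln t"
    using assms Gamma_pos by (simp add: ln_mult)
  (* u is the weight for which 1 is the convex combination of t and 2 *)
  define u where "u = (1 - t) / (2 - t)"
  have u: "0 < u" "u < 1" "u * (2 - t) = 1 - t"
    using assms by (auto simp: u_def)
  then have u_comb: "(1 - u) * t + u * 2 = 1"
    by (simp add: algebra_simps)
  have "ln (Gamma ((1 - u) * t + u * 2)) \<le> (1 - u) * ln (Gamma t) + u * ln (Gamma (2::real))"
    using convex_onD[OF log_convex_Gamma_real, of u t 2] assms u by simp
  then have "0 \<le> (1 - u) * ln (Gamma t)"
    using Gamma_2 u u_comb by simp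
  then have "0 \<le> ln (Gamma t)"
    using u by (simp add: zero_le_mult_iff)
  then show ?thesis
    using upper by (simp add: log_Gamma_def)
qed

text \<open>
  Comparison with the moments of \<open>- ln t\<close>. The quadratic decay in \<open>Re s\<close>
  is what makes the series of moments summable when the binomial coefficients are merely bounded.
\<close>

lemma
  assumes "Re s > 0"
  shows log_Gamma_moment_integrable:
      "set_integrable lborel {0<..<1} (\<lambda>t. complex_of_real t powr (s - 1) * log_Gamma t)"
    and norm_log_Gamma_moment_le:
      "(LINT t:{0<..<1}|lborel. norm (complex_of_real t powr (s - 1) * log_Gamma t))
         \<le> 1 / (Re s)\<^sup>2"
proof -
  let ?f = "\<lambda>t. complex_of_real t powr (s - 1) * log_Gamma t"
  have bound: "norm (?f t) \<le> t powr (Re s - 1) * (- ln t)" if "0 < t" "t < 1" for t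
    using mult_left_mono[OF norm_log_Gamma_le[OF that], of "t powr (Re s - 1)"] that
    by (simp add: norm_mult norm_powr_real_powr)
  have "continuous_on {0<..<1} ?f"
    unfolding log_Gamma_def
    by (intro continuous_intros) 
       (auto simp: Gamma_eq_zero_iff elim!: nonpos_Ints_cases)
  then have meas: "set_borel_measurable lborel {0<..<1} ?f"
    unfolding set_borel_measurable_def
    using borel_measurable_continuous_on_indicator[of "{0<..<1}" ?f] by simp
  show int: "set_integrable lborel {0<..<1} ?f"
    by (rule set_integrable_bound[OF neg_ln_moment_integrable[OF assms] meas])
       (use bound in force)
  have "(LINT t:{0<..<1}|lborel. norm (?f t))
      \<le> (LINT t:{0<..<1}|lborel. t powr (Re s - 1) * (- ln t))"
    by (rule set_integral_mono)
       (use bound int neg_ln_moment_integrable[OF assms] in \<open>auto intro: set_integrable_norm\<close>)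
  then show "(LINT t:{0<..<1}|lborel. norm (?f t)) \<le> 1 / (Re s)\<^sup>2"
    using neg_ln_moment_eq[OF assms] by simp
qed

lemma Gamma_nonzero_right_half_plane:
  fixes s :: complex
  assumes "Re s > 0"
  shows "Gamma s \<noteq> 0"
  using assms by (auto simp: Gamma_eq_zero_iff elim!: nonpos_Ints_cases)

lemma Gamma_mult_rl_right_0:
  assumes "Re s > 0"
  shows "Gamma s * rl_right b s f 0
    = (LINT t:{0<..<b}|lborel. complex_of_real t powr (s - 1) * f t)"
  using Gamma_nonzero_right_half_plane[OF assms]
  by (simp add: rl_right_def rl_right_kernel_def)

text \<open>
  The coefficient \<open>(\<alpha> - 1) gchoose n\<close> has the order of \<open>n\<^sup>-\<^sup>\<alpha>\<close>, or a smaller one when \<open>\<alpha>\<close> is a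
  positive integer and the binomial series terminates; \<open>n\<^sup>-\<^sup>\<alpha>\<close> is bounded when \<open>Re \<alpha> \<ge> 0\<close>.
\<close>

lemma gbinomial_bounded:
  fixes \<alpha> :: complex
  assumes "Re \<alpha> \<ge> 0"
  obtains K where "\<And>n. norm ((\<alpha> - 1) gchoose n) \<le> K"
proof -
  have "Bseq (\<lambda>n. ((\<alpha> - 1) gchoose n) / ((-1)^n / exp (\<alpha> * of_real (ln (real n)))))"
    using gbinomial_asymptotic[of "\<alpha> - 1"] by (auto intro: convergent_imp_Bseq convergentI)
  then obtain K where
    K: "\<And>n. norm (((\<alpha> - 1) gchoose n) / ((-1)^n / exp (\<alpha> * of_real (ln (real n))))) \<le> K"
    unfolding Bseq_def by auto
  have "norm ((\<alpha> - 1) gchoose n) \<le> K" for n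
  proof -
    (* the convention ln 0 = 0 makes the factor equal to 1 at n = 0 *)
    have "0 \<le> ln (real n)"
      by (cases "n = 0") auto
    then have "1 \<le> exp (Re \<alpha> * ln (real n))"
      using assms by simp
    then have "norm ((\<alpha> - 1) gchoose n) \<le> norm ((\<alpha> - 1) gchoose n) * exp (Re \<alpha> * ln (real n))"
      by (simp add: mult_le_cancel_left1)
    also have "\<dots> \<le> K"
      using K[of n] by (simp add: norm_mult norm_divide norm_power)
    finally show ?thesis .
  qed
  then show thesis by (rule that)
qed

lemma binomial_sums_one_minus_powr:
  fixes t :: real
  assumes "0 < t" "t < 1"
  shows "(\<lambda>n. (-1) ^ n * (z gchoose n) * complex_of_real t ^ n) sums complex_of_real (1 - t) powr z"
  using gen_binomial_complex[of "- complex_of_real t" z] assms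
  by (simp add: power_minus[of "complex_of_real t"] mult_ac)

text \<open>
  Termwise integration of the binomial series. The terms are summable in \<open>L\<^sup>1\<close>, and this yields
  not only the value of the integral but also the integrability of \<open>h\<close>, including its behaviour
  at 1, where the zero of \<open>log \<Gamma>\<close> compensates the singularity of \<open>(1 - t)\<^sup>\<alpha>\<^sup>-\<^sup>1\<close>.
\<close>

lemma
  assumes "Re \<alpha> \<ge> 0" and "Re \<beta> > 0"
  defines "c \<equiv> \<lambda>n::nat. (-1) ^ n * ((\<alpha> - 1) gchoose n)"
    and "m \<equiv> \<lambda>s. LINT t:{0<..<1}|lborel. complex_of_real t powr (s - 1) * log_Gamma t"
    and "h \<equiv> \<lambda>t. complex_of_real (1 - t) powr (\<alpha> - 1)
               * (complex_of_real t powr (\<beta> - 1) * log_Gamma t)"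
  shows log_Gamma_left_integrand_integrable: "set_integrable lborel {0<..<1} h"
    and log_Gamma_moments_sums_left_integral:
      "(\<lambda>n. c n * m (of_nat n + \<beta>)) sums (LINT t:{0<..<1}|lborel. h t)"
proof -
  define g where "g = (\<lambda>(n::nat) t. complex_of_real t powr (of_nat n + \<beta> - 1) * log_Gamma t)"
  define f where "f = (\<lambda>n t. indicator {0<..<1} t *\<^sub>R (c n * g n t))"
  have Re_pos: "Re (of_nat n + \<beta>) > 0" for n
    using assms by (simp add: add_nonneg_pos)
  obtain K where "\<And>n. norm ((\<alpha> - 1) gchoose n) \<le> K"
    using gbinomial_bounded[OF \<open>Re \<alpha> \<ge> 0\<close>] by blast
  then have K: "norm (c n) \<le> K" for n
    by (simp add: c_def norm_mult norm_power)
  have K_nonneg: "0 \<le> K"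
    using K[of 0] norm_ge_zero order_trans by blast
  have int_g: "set_integrable lborel {0<..<1} (g n)" for n
    unfolding g_def by (rule log_Gamma_moment_integrable[OF Re_pos])
  have int_f: "integrable lborel (f n)" for n
    using int_g[of n] unfolding f_def set_integrable_def[symmetric] by simp
  have g_eq: "g n t = complex_of_real t ^ n * (complex_of_real t powr (\<beta> - 1) * log_Gamma t)"
    if "t > 0" for n t
  proof -
    have "of_nat n + \<beta> - 1 = of_nat n + (\<beta> - 1)" by simp
    then show ?thesis
      using that by (simp only: g_def powr_add powr_nat') simp
  qed
  have f_sums: "(\<lambda>n. f n t) sums (indicator {0<..<1} t *\<^sub>R h t)" for t
  proof (cases "t \<in> {0<..<1}")
    case True
    then show ?thesis
      using sums_mult2[OF binomial_sums_one_minus_powr[of t "\<alpha> - 1"],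
          of "complex_of_real t powr (\<beta> - 1) * log_Gamma t"]
      by (simp add: f_def g_eq h_def c_def mult_ac)
  qed (simp add: f_def)
  have summable_norm_f: "summable (\<lambda>n. norm (f n t))" for t
  proof (cases "t \<in> {0<..<1}")
    case True
    let ?B = "K * norm (complex_of_real t powr (\<beta> - 1) * log_Gamma t)"
    show ?thesis
    proof (rule summable_comparison_test')
      show "summable (\<lambda>n. ?B * t ^ n)"
        using True by (intro summable_mult summable_geometric) auto
      show "norm (norm (f n t)) \<le> ?B * t ^ n" if "0 \<le> n" for n
        using mult_right_mono[OF K[of n],
            of "norm (complex_of_real t powr (\<beta> - 1) * log_Gamma t) * t ^ n"] True
        by (simp add: f_def g_eq norm_mult norm_power mult_ac)
    qed
  qed (simp add: f_def)
  have "summable (\<lambda>n. LINT t|lborel. norm (f n t))"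
  proof (rule summable_comparison_test')
    show "summable (\<lambda>n. K * (1 / real n ^ 2))"
      using inverse_power_summable[of 2, where 'a = real]
      by (intro summable_mult) (simp add: field_simps)
    show "norm (LINT t|lborel. norm (f n t)) \<le> K * (1 / real n ^ 2)" if "1 \<le> n" for n
    proof -
      have "(LINT t|lborel. norm (f n t)) = norm (c n) * (LINT t:{0<..<1}|lborel. norm (g n t))"
        by (simp add: f_def set_lebesgue_integral_def norm_mult mult_ac)
      also have "\<dots> \<le> K * (1 / (Re (of_nat n + \<beta>))\<^sup>2)"
        using K K_nonneg norm_log_Gamma_moment_le[OF Re_pos, of n]
        by (intro mult_mono) (auto simp: g_def set_lebesgue_integral_def)
      also have "\<dots> \<le> K * (1 / real n ^ 2)"
        using K_nonneg that assms
        by (intro mult_left_mono divide_left_mono power_mono mult_pos_pos) auto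
      finally show ?thesis by simp
    qed
  qed
  note swap = int_f AE_I2[OF summable_norm_f] this
  have suminf_f: "(\<Sum>n. f n t) = indicator {0<..<1} t *\<^sub>R h t" for t
    using f_sums by (simp add: sums_iff)
  show "set_integrable lborel {0<..<1} h"
    using integrable_suminf[OF swap] by (simp add: suminf_f set_integrable_def)
  have "integral\<^sup>L lborel (f n) = c n * m (of_nat n + \<beta>)" for n
    by (simp add: f_def g_def m_def flip: set_lebesgue_integral_def)
  then show "(\<lambda>n. c n * m (of_nat n + \<beta>)) sums (LINT t:{0<..<1}|lborel. h t)"
    using sums_integral[OF swap] by (simp add: suminf_f set_lebesgue_integral_def)
qed

theorem theorem3:
  fixes \<alpha> \<beta> :: complex
  assumes "Re \<alpha> > 0" and "Re \<beta> \<ge> 1"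
  shows "rl_left_exists 0 \<alpha> (\<lambda>x. complex_of_real x powr (\<beta> - 1) * log_Gamma x) 1
    \<and> (\<forall>n::nat. rl_right_exists 1 (of_nat n + \<beta>) log_Gamma 0)
    \<and> summable (\<lambda>n::nat. (-1) ^ n * ((\<alpha> - 1) gchoose n) * Gamma (of_nat n + \<beta>)
          * rl_right 1 (of_nat n + \<beta>) log_Gamma 0)
    \<and> rl_left 0 \<alpha> (\<lambda>x. complex_of_real x powr (\<beta> - 1) * log_Gamma x) 1 =
        1 / Gamma \<alpha> * (\<Sum>n::nat. (-1) ^ n * ((\<alpha> - 1) gchoose n) * Gamma (of_nat n + \<beta>)
          * rl_right 1 (of_nat n + \<beta>) log_Gamma 0)
    \<and> rl_right_exists 1 \<alpha> (\<lambda>x. complex_of_real x powr (\<beta> - 1) * log_Gamma x) 0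
    \<and> rl_right_exists 1 (\<alpha> + \<beta> - 1) log_Gamma 0
    \<and> rl_right 1 \<alpha> (\<lambda>x. complex_of_real x powr (\<beta> - 1) * log_Gamma x) 0 =
        Gamma (\<alpha> + \<beta> - 1) / Gamma \<alpha> * rl_right 1 (\<alpha> + \<beta> - 1) log_Gamma 0"
proof (intro conjI allI)
  let ?f = "\<lambda>x. complex_of_real x powr (\<beta> - 1) * log_Gamma x"
  have Re_pos: "Re (of_nat n + \<beta>) > 0" for n :: nat
    using assms by (simp add: add_nonneg_pos)
  have Re_pos': "Re (\<alpha> + \<beta> - 1) > 0"
    using assms by simp
  have \<alpha>\<beta>: "Re \<alpha> \<ge> 0" "Re \<beta> > 0"
    using assms by auto
  have exists_moment: "rl_right_exists 1 s log_Gamma 0" if "Re s > 0" for s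
    using log_Gamma_moment_integrable[OF that]
    by (simp add: rl_right_exists_def rl_right_kernel_def[abs_def])
  have series: "(\<lambda>n::nat. (-1) ^ n * ((\<alpha> - 1) gchoose n) * Gamma (of_nat n + \<beta>)
      * rl_right 1 (of_nat n + \<beta>) log_Gamma 0)
    sums (LINT t:{0<..<1}|lborel. rl_left_kernel \<alpha> ?f 1 t)"
    using log_Gamma_moments_sums_left_integral[OF \<alpha>\<beta>]
    by (simp only: rl_left_kernel_def Gamma_mult_rl_right_0[OF Re_pos, symmetric] mult.assoc)
  show "rl_left_exists 0 \<alpha> ?f 1"
    using log_Gamma_left_integrand_integrable[OF \<alpha>\<beta>]
    by (simp add: rl_left_exists_def rl_left_kernel_def[abs_def])
  show "rl_right_exists 1 (of_nat n + \<beta>) log_Gamma 0" for n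
    by (rule exists_moment[OF Re_pos])
  show "summable (\<lambda>n::nat. (-1) ^ n * ((\<alpha> - 1) gchoose n) * Gamma (of_nat n + \<beta>)
          * rl_right 1 (of_nat n + \<beta>) log_Gamma 0)"
    using series by (rule sums_summable)
  show "rl_left 0 \<alpha> ?f 1 =
        1 / Gamma \<alpha> * (\<Sum>n::nat. (-1) ^ n * ((\<alpha> - 1) gchoose n) * Gamma (of_nat n + \<beta>)
          * rl_right 1 (of_nat n + \<beta>) log_Gamma 0)"
    unfolding rl_left_def sums_unique[OF series, symmetric] ..
  have kernel: "rl_right_kernel \<alpha> ?f 0 = rl_right_kernel (\<alpha> + \<beta> - 1) log_Gamma 0"
    by (simp add: rl_right_kernel_def fun_eq_iff powr_add[symmetric] algebra_simps
        flip: mult.assoc)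
  show "rl_right_exists 1 (\<alpha> + \<beta> - 1) log_Gamma 0"
    by (rule exists_moment[OF Re_pos'])
  then show "rl_right_exists 1 \<alpha> ?f 0"
    unfolding rl_right_exists_def kernel .
  show "rl_right 1 \<alpha> ?f 0 = Gamma (\<alpha> + \<beta> - 1) / Gamma \<alpha> * rl_right 1 (\<alpha> + \<beta> - 1) log_Gamma 0"
    unfolding rl_right_def kernel
    using Gamma_nonzero_right_half_plane[OF Re_pos'] by simp
qed

end
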